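(* Let $(Z,\mathfrak{I},E)$ be a soft connected space. If $\mathfrak{I}$ is maximal soft connected, then $(Z,\mathfrak{I},E)$ is soft $T_0$.
   Context: A soft set over $Z$ with parameter set $E$ is a pair $(Y,E)$ where $Y:E\to\mathcal{P}(Z)$ is a map. Inclusion, unions, intersections and complements of soft sets are taken parameterwise. The null soft set $\widetilde{\Phi}$ is $\emptyset$ at every $e$; the absolute soft set $\widetilde{Z}$ is $Z$ at every $e$. A soft topology on $Z$ is a collection $\mathfrak{I}$ of soft sets over $Z$ containing $\widetilde{\Phi},\widetilde{Z}$, closed under intersections of two members and under arbitrary unions; $(Z,\mathfrak{I},E)$ is then a soft topological space and members of $\mathfrak{I}$ are soft open. The space is soft connected if $\widetilde{Z}$ is not the union of two disjoint non-null soft open sets (disjoint: intersection equal to $\widetilde{\Phi}$). $\mathfrak{I}$ is maximal soft connected if it is soft connected and no soft topology on $Z$ (with parameter set $E$) strictly containing $\mathfrak{I}$ is soft connected. For $z\in Z$, $e\in E$, the soft point $z(e)$ is the soft set equal to $\{z\}$ at $e$ and $\emptyset$ at every other parameter; $z(e)\,\widetilde{\in}\,(Y,E)$ means $z\in Y(e)$. Soft points $u(e),v(e')$ are distinct if $u\ne v$ or $e\ne e'$. The space is soft $T_0$ if for any two distinct soft points there is a soft open set containing exactly one of them. *)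

theory Defs
  imports Main "HOL-Library.FuncSet"
begin

text \<open>A soft set \<open>(Y, E)\<close> over \<open>Z\<close> is a map from the set \<open>E\<close> to the power set of \<open>Z\<close>. It is encoded as an
  extensional function (value \<^term>\<open>undefined\<close> outside \<open>E\<close>), so that equality of functions is
  equality of soft sets. Neither \<open>Z\<close> nor \<open>E\<close> is required to be nonempty.\<close>

definition soft_sets :: "'z set \<Rightarrow> 'e set \<Rightarrow> ('e \<Rightarrow> 'z set) set"
  where "soft_sets Z E = E \<rightarrow>\<^sub>E Pow Z"

definition null_soft :: "'e set \<Rightarrow> 'e \<Rightarrow> 'z set"
  where "null_soft E = (\<lambda>e\<in>E. {})"

definition absolute_soft :: "'z set \<Rightarrow> 'e set \<Rightarrow> 'e \<Rightarrow> 'z set"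
  where "absolute_soft Z E = (\<lambda>e\<in>E. Z)"

definition soft_Int :: "'e set \<Rightarrow> ('e \<Rightarrow> 'z set) \<Rightarrow> ('e \<Rightarrow> 'z set) \<Rightarrow> 'e \<Rightarrow> 'z set"
  where "soft_Int E A B = (\<lambda>e\<in>E. A e \<inter> B e)"

definition soft_Un :: "'e set \<Rightarrow> ('e \<Rightarrow> 'z set) \<Rightarrow> ('e \<Rightarrow> 'z set) \<Rightarrow> 'e \<Rightarrow> 'z set"
  where "soft_Un E A B = (\<lambda>e\<in>E. A e \<union> B e)"

definition soft_Union :: "'e set \<Rightarrow> ('e \<Rightarrow> 'z set) set \<Rightarrow> 'e \<Rightarrow> 'z set"
  where "soft_Union E \<C> = (\<lambda>e\<in>E. \<Union>Y\<in>\<C>. Y e)"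

definition soft_topology :: "'z set \<Rightarrow> 'e set \<Rightarrow> ('e \<Rightarrow> 'z set) set \<Rightarrow> bool"
  where "soft_topology Z E \<T> \<longleftrightarrow>
    \<T> \<subseteq> soft_sets Z E \<and>
    null_soft E \<in> \<T> \<and> absolute_soft Z E \<in> \<T> \<and>
    (\<forall>A\<in>\<T>. \<forall>B\<in>\<T>. soft_Int E A B \<in> \<T>) \<and>
    (\<forall>\<C>. \<C> \<subseteq> \<T> \<longrightarrow> soft_Union E \<C> \<in> \<T>)"

definition soft_connected :: "'z set \<Rightarrow> 'e set \<Rightarrow> ('e \<Rightarrow> 'z set) set \<Rightarrow> bool"
  where "soft_connected Z E \<T> \<longleftrightarrow>
    \<not> (\<exists>A\<in>\<T>. \<exists>B\<in>\<T>. A \<noteq> null_soft E \<and> B \<noteq> null_soft E \<and>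
          soft_Int E A B = null_soft E \<and> absolute_soft Z E = soft_Un E A B)"

definition maximal_soft_connected :: "'z set \<Rightarrow> 'e set \<Rightarrow> ('e \<Rightarrow> 'z set) set \<Rightarrow> bool"
  where "maximal_soft_connected Z E \<T> \<longleftrightarrow>
    soft_connected Z E \<T> \<and>
    \<not> (\<exists>\<T>'. soft_topology Z E \<T>' \<and> \<T> \<subset> \<T>' \<and> soft_connected Z E \<T>')"

definition soft_point :: "'e set \<Rightarrow> 'z \<Rightarrow> 'e \<Rightarrow> 'e \<Rightarrow> 'z set"
  where "soft_point E z e = (\<lambda>e'\<in>E. if e' = e then {z} else {})"

definition soft_mem :: "'e set \<Rightarrow> ('e \<Rightarrow> 'z set) \<Rightarrow> ('e \<Rightarrow> 'z set) \<Rightarrow> bool"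
  where "soft_mem E P Y \<longleftrightarrow> (\<exists>z. \<exists>e\<in>E. P = soft_point E z e \<and> z \<in> Y e)"

lemma soft_point_eq_iff:
  assumes "e \<in> E" "e' \<in> E"
  shows "soft_point E u e = soft_point E v e' \<longleftrightarrow> u = v \<and> e = e'"
proof
  assume "soft_point E u e = soft_point E v e'"
  then have "soft_point E u e e = soft_point E v e' e" by simp
  then show "u = v \<and> e = e'"
    using assms by (auto simp: soft_point_def split: if_splits)
qed simp

lemma soft_mem_soft_point_iff:
  assumes "e \<in> E"
  shows "soft_mem E (soft_point E z e) Y \<longleftrightarrow> z \<in> Y e"
  using assms by (auto simp: soft_mem_def soft_point_eq_iff)

definition soft_T0 :: "'z set \<Rightarrow> 'e set \<Rightarrow> ('e \<Rightarrow> 'z set) set \<Rightarrow> bool"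
  where "soft_T0 Z E \<T> \<longleftrightarrow>
    (\<forall>u\<in>Z. \<forall>v\<in>Z. \<forall>e\<in>E. \<forall>e'\<in>E. u \<noteq> v \<or> e \<noteq> e' \<longrightarrow>
      (\<exists>Y\<in>\<T>. soft_mem E (soft_point E u e) Y \<noteq> soft_mem E (soft_point E v e') Y))"

end

theory Submission
  imports Defs
begin

text \<open>A soft topology that is not soft \<open>T\<^sub>0\<close> can be refined by one step without losing
  connectedness, so it is not maximal. Suppose that two distinct soft points \<open>p\<close> and \<open>q\<close> lie in the
  same soft open sets. Declaring the complement of \<open>p\<close> to be open adds just the sets \<open>U - p\<close> with
  \<open>U\<close> soft open; these form a soft topology together with the old open sets
  (\<open>soft_topology_puncture\<close>). It is strictly finer, because the complement of \<open>p\<close> contains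
  \<open>q\<close> and omits \<open>p\<close>.

  It is also connected (\<open>soft_connected_puncture\<close>). In a separation, the part that
  contains \<open>p\<close> cannot be one of the new sets, so it is an old open set and contains \<open>q\<close> too. The other
  part then omits \<open>q\<close>, and it has the form \<open>V\<close> or \<open>V - p\<close> with \<open>V\<close> an old open set. In either case
  \<open>V\<close> omits \<open>q\<close>, hence omits \<open>p\<close>, so the other part equals \<open>V\<close>: the separation consists of old open
  sets and contradicts the connectedness of the original space.\<close>

definition soft_remove :: "'e set \<Rightarrow> 'z \<Rightarrow> 'e \<Rightarrow> ('e \<Rightarrow> 'z set) \<Rightarrow> 'e \<Rightarrow> 'z set"
  where "soft_remove E u e U = (\<lambda>x\<in>E. U x - (if x = e then {u} else {}))"

definition puncture :: "'e set \<Rightarrow> 'z \<Rightarrow> 'e \<Rightarrow> ('e \<Rightarrow> 'z set) set \<Rightarrow> ('e \<Rightarrow> 'z set) set"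
  where "puncture E u e \<T> = \<T> \<union> soft_remove E u e ` \<T>"

lemma soft_set_eqI:
  assumes "A \<in> extensional E" "B \<in> extensional E" "\<And>x z. x \<in> E \<Longrightarrow> z \<in> A x \<longleftrightarrow> z \<in> B x"
  shows "A = B"
  using assms by (intro extensionalityI) auto

lemma soft_topology_extensional:
  assumes "soft_topology Z E \<T>" "A \<in> \<T>"
  shows "A \<in> extensional E"
  using assms by (auto simp: soft_topology_def soft_sets_def PiE_def)

lemma soft_remove_eq_self:
  assumes "U \<in> extensional E" "u \<notin> U e"
  shows "soft_remove E u e U = U"
  using assms by (intro soft_set_eqI) (auto simp: soft_remove_def)

lemma soft_remove_in_soft_sets:
  assumes "U \<in> soft_sets Z E"
  shows "soft_remove E u e U \<in> soft_sets Z E"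
  using assms by (fastforce simp: soft_remove_def soft_sets_def)

text \<open>The new sets do not contain the removed point, so a member of the finer topology that does
  contain it is an old open set.\<close>

lemma puncture_memD:
  assumes "A \<in> puncture E u e \<T>" "e \<in> E" "u \<in> A e"
  shows "A \<in> \<T>"
  using assms by (auto simp: puncture_def soft_remove_def)

lemma puncture_Int:
  assumes top: "soft_topology Z E \<T>" and "A \<in> puncture E u e \<T>" "B \<in> puncture E u e \<T>"
  shows "soft_Int E A B \<in> puncture E u e \<T>"
proof -
  obtain U where U: "U \<in> \<T>" "A = U \<or> A = soft_remove E u e U"
    using assms(2) by (auto simp: puncture_def)
  obtain V where V: "V \<in> \<T>" "B = V \<or> B = soft_remove E u e V"
    using assms(3) by (auto simp: puncture_def)
  have "soft_Int E U V \<in> \<T>"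
    using top U(1) V(1) by (auto simp: soft_topology_def)
  moreover have "soft_Int E (soft_remove E u e U) V = soft_remove E u e (soft_Int E U V)"
    "soft_Int E U (soft_remove E u e V) = soft_remove E u e (soft_Int E U V)"
    "soft_Int E (soft_remove E u e U) (soft_remove E u e V) = soft_remove E u e (soft_Int E U V)"
    by (rule soft_set_eqI; auto simp: soft_Int_def soft_remove_def)+
  ultimately show ?thesis
    using U(2) V(2) unfolding puncture_def by auto
qed

text \<open>Replacing each new set by the old open sets it comes from changes the union at most at the
  removed point. The union of the family is therefore an old open set \<open>W\<close>, or \<open>W\<close> without that
  point, according to whether the family covers the point.\<close>

lemma puncture_Union:
  assumes top: "soft_topology Z E \<T>" and \<C>: "\<C> \<subseteq> puncture E u e \<T>"
  shows "soft_Union E \<C> \<in> puncture E u e \<T>"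
proof -
  define \<D> where "\<D> = {U \<in> \<T>. U \<in> \<C> \<or> soft_remove E u e U \<in> \<C>}"
  let ?W = "soft_Union E \<D>"
  have W: "?W \<in> \<T>"
    using top by (auto simp: soft_topology_def \<D>_def)
  have up: "z \<in> ?W x" if xz: "x \<in> E" "z \<in> soft_Union E \<C> x" for x z
  proof -
    obtain A where A: "A \<in> \<C>" "z \<in> A x"
      using xz by (auto simp: soft_Union_def)
    obtain U where "U \<in> \<T>" "A = U \<or> A = soft_remove E u e U"
      using A(1) \<C> by (auto simp: puncture_def)
    then show ?thesis
      using A xz by (auto simp: soft_Union_def \<D>_def soft_remove_def)
  qed
  have down: "z \<in> soft_Union E \<C> x" if xz: "x \<in> E" "z \<in> ?W x" "\<not> (x = e \<and> z = u)" for x z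
  proof -
    obtain U where U: "U \<in> \<C> \<or> soft_remove E u e U \<in> \<C>" "z \<in> U x"
      using xz by (auto simp: soft_Union_def \<D>_def)
    have "z \<in> soft_remove E u e U x"
      using xz U(2) by (auto simp: soft_remove_def)
    with U xz(1) show ?thesis
      by (auto simp: soft_Union_def)
  qed
  show ?thesis
  proof (cases "u \<in> soft_Union E \<C> e")
    case True
    have "soft_Union E \<C> = ?W"
    proof (rule soft_set_eqI)
      show "z \<in> soft_Union E \<C> x \<longleftrightarrow> z \<in> ?W x" if "x \<in> E" for x z
        using up[OF that, of z] down[OF that, of z] True by auto
    qed (auto simp: soft_Union_def)
    with W show ?thesis
      by (simp add: puncture_def)
  next
    case False
    have "soft_Union E \<C> = soft_remove E u e ?W"
    proof (rule soft_set_eqI)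
      show "z \<in> soft_Union E \<C> x \<longleftrightarrow> z \<in> soft_remove E u e ?W x" if "x \<in> E" for x z
        using up[of x z] down[of x z] False that by (auto simp: soft_remove_def)
    qed (auto simp: soft_Union_def soft_remove_def)
    with W show ?thesis
      by (simp add: puncture_def)
  qed
qed

lemma soft_topology_puncture:
  assumes "soft_topology Z E \<T>"
  shows "soft_topology Z E (puncture E u e \<T>)"
proof -
  have "puncture E u e \<T> \<subseteq> soft_sets Z E"
    using assms by (auto simp: soft_topology_def puncture_def intro!: soft_remove_in_soft_sets)
  moreover have "null_soft E \<in> puncture E u e \<T>" "absolute_soft Z E \<in> puncture E u e \<T>"
    using assms by (auto simp: soft_topology_def puncture_def)
  ultimately show ?thesis
    using puncture_Int[OF assms] puncture_Union[OF assms] by (simp add: soft_topology_def)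
qed

text \<open>If every old open set around \<open>p = u(e)\<close> also contains another point \<open>q = v(e')\<close> and conversely,
  then a set disjoint from an old neighbourhood of \<open>p\<close> gains no openness from the removal of \<open>p\<close>:
  it omits \<open>q\<close>, so an old open set that yields it by removal of \<open>p\<close> omits \<open>q\<close>, and with it \<open>p\<close>.\<close>

lemma puncture_disjointD:
  assumes top: "soft_topology Z E \<T>"
    and "e \<in> E" "e' \<in> E" and dist: "u \<noteq> v \<or> e \<noteq> e'"
    and indist: "\<And>Y. Y \<in> \<T> \<Longrightarrow> u \<in> Y e \<longleftrightarrow> v \<in> Y e'"
    and A: "A \<in> \<T>" "u \<in> A e"
    and B: "B \<in> puncture E u e \<T>" and disj: "soft_Int E A B = null_soft E"
  shows "B \<in> \<T>"
proof -
  have "v \<in> A e'"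
    using indist A by blast
  moreover have "A e' \<inter> B e' = {}"
    using fun_cong[OF disj, of e'] \<open>e' \<in> E\<close> by (simp add: soft_Int_def null_soft_def)
  ultimately have "v \<notin> B e'"
    by blast
  obtain V where V: "V \<in> \<T>" "B = V \<or> B = soft_remove E u e V"
    using B by (auto simp: puncture_def)
  have "v \<notin> V e'"
    using V(2) \<open>v \<notin> B e'\<close> \<open>e' \<in> E\<close> dist by (auto simp: soft_remove_def split: if_splits)
  then have "u \<notin> V e"
    using indist V(1) by blast
  then have "B = V"
    using V soft_remove_eq_self soft_topology_extensional[OF top V(1)] by metis
  then show ?thesis
    using V(1) by simp
qed

lemma soft_connected_puncture:
  assumes top: "soft_topology Z E \<T>" and conn: "soft_connected Z E \<T>"
    and "e \<in> E" "e' \<in> E" "u \<in> Z" and "u \<noteq> v \<or> e \<noteq> e'"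
    and indist: "\<And>Y. Y \<in> \<T> \<Longrightarrow> u \<in> Y e \<longleftrightarrow> v \<in> Y e'"
  shows "soft_connected Z E (puncture E u e \<T>)"
  unfolding soft_connected_def
proof (rule notI, elim bexE conjE)
  fix A B
  assume AB: "A \<in> puncture E u e \<T>" "B \<in> puncture E u e \<T>"
    and nonnull: "A \<noteq> null_soft E" "B \<noteq> null_soft E"
    and disj: "soft_Int E A B = null_soft E" and cover: "absolute_soft Z E = soft_Un E A B"
  have disj': "soft_Int E B A = null_soft E"
    using disj by (simp add: soft_Int_def Int_commute)
  have "u \<in> A e \<or> u \<in> B e"
    using fun_cong[OF cover, of e] \<open>e \<in> E\<close> \<open>u \<in> Z\<close>
    by (auto simp: absolute_soft_def soft_Un_def)
  then have "A \<in> \<T> \<and> B \<in> \<T>"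
  proof
    assume "u \<in> A e"
    moreover have "A \<in> \<T>"
      using puncture_memD[OF AB(1) \<open>e \<in> E\<close> \<open>u \<in> A e\<close>] .
    ultimately show ?thesis
      using puncture_disjointD[OF top assms(3,4,6) indist _ _ AB(2) disj] by blast
  next
    assume "u \<in> B e"
    moreover have "B \<in> \<T>"
      using puncture_memD[OF AB(2) \<open>e \<in> E\<close> \<open>u \<in> B e\<close>] .
    ultimately show ?thesis
      using puncture_disjointD[OF top assms(3,4,6) indist _ _ AB(1) disj'] by blast
  qed
  with conn nonnull disj cover show False
    unfolding soft_connected_def by blast
qed

theorem theorem3p29:
  fixes Z :: "'z set" and E :: "'e set" and \<T> :: "('e \<Rightarrow> 'z set) set"
  assumes "soft_topology Z E \<T>"
    and "soft_connected Z E \<T>"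
    and "maximal_soft_connected Z E \<T>"
  shows "soft_T0 Z E \<T>"
proof (rule ccontr)
  assume "\<not> soft_T0 Z E \<T>"
  then obtain u v e e' where pts: "u \<in> Z" "v \<in> Z" "e \<in> E" "e' \<in> E" "u \<noteq> v \<or> e \<noteq> e'"
    and indist: "\<And>Y. Y \<in> \<T> \<Longrightarrow> u \<in> Y e \<longleftrightarrow> v \<in> Y e'"
    by (auto simp: soft_T0_def soft_mem_soft_point_iff)
  let ?D = "soft_remove E u e (absolute_soft Z E)"
  have "u \<notin> ?D e" "v \<in> ?D e'"
    using pts by (auto simp: soft_remove_def absolute_soft_def)
  then have "?D \<notin> \<T>"
    using indist by blast
  moreover have "?D \<in> puncture E u e \<T>"
    using assms(1) by (simp add: puncture_def soft_topology_def)
  ultimately have "\<T> \<subset> puncture E u e \<T>"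
    by (auto simp: puncture_def)
  moreover have "soft_topology Z E (puncture E u e \<T>)"
    using soft_topology_puncture[OF assms(1)] .
  moreover have "soft_connected Z E (puncture E u e \<T>)"
    using soft_connected_puncture[OF assms(1,2) pts(3,4,1,5) indist] .
  ultimately show False
    using assms(3) unfolding maximal_soft_connected_def by blast
qed

end
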